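(* Let $G$ be a (finite simple) chordal graph and let $x$ be a nondominating vertex of $G$. Then there exists a vertex $y$ in $G$ (with $y\ne x$) such that $y$ is nonadjacent to $x$ and the graph $G+xy$ is also chordal.
   Context: All graphs are finite and simple. A chord of a cycle $C$ in a graph is an edge of the graph not in $E(C)$ both of whose endpoints lie on $C$. A graph is chordal if every cycle of length greater than three has a chord (equivalently, it contains no induced cycle of length greater than three). Chordal graphs are not required to be connected. A vertex $x$ in a graph of order (number of vertices) $n$ is called dominating if its degree is $n-1$; otherwise it is nondominating. For nonadjacent distinct vertices $x,y$ of $G$, $G+xy$ denotes the graph obtained from $G$ by adding the edge $xy$. *)

theory Defs
  imports "Graph_Theory.Pair_Digraph"
begin

text \<open>
  A finite simple graph is a \<^locale>\<open>pair_graph\<close>: finite, loopfree and symmetric, with an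
  edge \<open>uv\<close> represented by the two arcs \<open>(u, v)\<close> and \<open>(v, u)\<close>.
\<close>

text \<open>
  In a symmetric digraph the library's \<^const>\<open>pre_digraph.cycle\<close> also admits the closed walk
  \<open>[(u, v), (v, u)]\<close>; the cycles of length at least 3 are exactly the cycles of the graph. A
  cycle traverses each of its edges in one direction only, so both arcs of the edge \<open>uv\<close> have to
  be tested for membership.
\<close>

definition chord :: "'a pair_pre_digraph \<Rightarrow> ('a \<times> 'a) list \<Rightarrow> 'a \<Rightarrow> 'a \<Rightarrow> bool" where
  "chord G p u v \<longleftrightarrow> (u, v) \<in> parcs G \<and> (u, v) \<notin> set p \<and> (v, u) \<notin> set p \<and>
     u \<in> fst ` set p \<and> v \<in> fst ` set p"

definition chordal :: "'a pair_pre_digraph \<Rightarrow> bool" where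
  "chordal G \<longleftrightarrow>
     (\<forall>p. pre_digraph.cycle (with_proj G) p \<and> length p > 3 \<longrightarrow> (\<exists>u v. chord G p u v))"

text \<open>By symmetry, the degree of a vertex is the number of its outgoing arcs.\<close>

definition dominating :: "'a pair_pre_digraph \<Rightarrow> 'a \<Rightarrow> bool" where
  "dominating G x \<longleftrightarrow> out_degree (with_proj G) x = card (pverts G) - 1"

definition add_edge :: "'a pair_pre_digraph \<Rightarrow> 'a \<Rightarrow> 'a \<Rightarrow> 'a pair_pre_digraph" where
  "add_edge G x y = G\<lparr>parcs := parcs G \<union> {(x, y), (y, x)}\<rparr>"

lemma pair_graph_add_edge:
  assumes "pair_graph G" and "x \<in> pverts G" and "y \<in> pverts G" and "x \<noteq> y"
  shows "pair_graph (add_edge G x y)"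
proof -
  interpret pair_graph G by fact
  show ?thesis
    using assms(2-4) pair_finite_verts pair_finite_arcs wellformed' arcs_symmetric no_loops'
    by unfold_locales (auto simp: add_edge_def symmetric_def intro!: symI)
qed

end

theory Submission
  imports Defs "HOL-Number_Theory.Cong"
begin

text \<open>
  Among the vertices nonadjacent to \<open>x\<close>, choose \<open>y\<close> with the largest number of common neighbours
  with \<open>x\<close>. If \<open>G + xy\<close> had an induced cycle of length greater than three, it would pass through
  the edge \<open>xy\<close>, and the rest of it would be an induced path \<open>x, b\<^sub>1, b\<^sub>2, \<dots>, y\<close> of \<open>G\<close> with at
  least four vertices. In a chordal graph, a vertex adjacent to both ends of an induced path is
  adjacent to all of it, so the common neighbours of \<open>x\<close> and \<open>y\<close> are also neighbours of \<open>b\<^sub>2\<close>. But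
  \<open>b\<^sub>1\<close> is adjacent to \<open>x\<close> and \<open>b\<^sub>2\<close> and not to \<open>y\<close>, so \<open>b\<^sub>2\<close> contradicts the choice of \<open>y\<close>.
\<close>

section \<open>Chordality as the absence of holes\<close>

text \<open>An induced cycle given by its vertices with cyclic indices: the equivalence demands the
  cycle edges and forbids chords at once. Indexing vertices instead of listing arcs turns rotating
  and reversing into index substitutions.\<close>

definition hole :: "'a pair_pre_digraph \<Rightarrow> nat \<Rightarrow> (nat \<Rightarrow> 'a) \<Rightarrow> bool" where
  "hole G n a \<longleftrightarrow> 3 < n \<and> inj_on a {..<n} \<and>
     (\<forall>i<n. \<forall>j<n. (a i, a j) \<in> parcs G \<longleftrightarrow> Suc i mod n = j \<or> Suc j mod n = i)"

lemma pcas_iff_map: "pcas u p v \<longleftrightarrow> map fst p @ [v] = u # map snd p"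
  by (induction p arbitrary: u) auto

lemma pawalk_verts_eq_map: "pcas u p v \<Longrightarrow> pawalk_verts u p = u # map snd p"
  by (induction p arbitrary: u) auto

text \<open>In a closed walk the heads of the arcs are the tails shifted cyclically by one. The base
  vertex is then forced to be the first tail, and distinct heads amount to distinct tails.\<close>

lemma (in pair_wf_digraph) cycle_iff_rotate1:
  "cycle p \<longleftrightarrow>
     p \<noteq> [] \<and> set p \<subseteq> parcs G \<and> distinct (map fst p) \<and> map snd p = rotate1 (map fst p)"
proof -
  have "awalk u p u \<and> distinct (tl (pawalk_verts u p)) \<longleftrightarrow>
      set p \<subseteq> parcs G \<and> distinct (map fst p) \<and> u = fst (hd p) \<and> map snd p = rotate1 (map fst p)"
    if "p \<noteq> []" for u
  proof -
    have walk: "pcas u p u \<longleftrightarrow> u = fst (hd p) \<and> map snd p = rotate1 (map fst p)"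
      using that by (cases p) (auto simp: pcas_iff_map)
    moreover have "distinct (tl (pawalk_verts u p)) \<longleftrightarrow> distinct (map fst p)" if "pcas u p u"
      using that walk pawalk_verts_eq_map[OF that] by (metis distinct1_rotate list.sel(3))
    moreover have "u \<in> pverts G" if "set p \<subseteq> parcs G" "u = fst (hd p)"
      using that arc_fst_in_verts[of "hd p"] hd_in_set[OF \<open>p \<noteq> []\<close>] by blast
    ultimately show ?thesis
      unfolding awalk_def by blast
  qed
  then show ?thesis
    unfolding cycle_def by blast
qed

text \<open>The tails of a chordless cycle, in order, form a hole, and the arcs between successive
  vertices of a hole form a chordless cycle.\<close>

lemma chordal_iff_no_hole:
  assumes "pair_graph G"
  shows "chordal G \<longleftrightarrow> (\<nexists>n a. hole G n a)"
proof -
  interpret pair_graph G by fact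
  have hole_if: "\<exists>n a. hole G n a"
    if "cycle p" "3 < length p" and no_chord: "\<And>u v. \<not> chord G p u v" for p
  proof -
    define n a where "n = length p" and "a = (\<lambda>i. fst (p ! i))"
    have p: "set p \<subseteq> parcs G" "distinct (map fst p)" "map snd p = rotate1 (map fst p)"
      using \<open>cycle p\<close> cycle_iff_rotate1 by auto
    have nth: "p ! i = (a i, a (Suc i mod n))" if "i < n" for i
    proof (rule prod_eqI)
      have "Suc i mod n < n"
        using that by simp
      have "snd (p ! i) = rotate1 (map fst p) ! i"
        using p(3) that by (metis n_def nth_map)
      also have "\<dots> = a (Suc i mod n)"
        using that \<open>Suc i mod n < n\<close> unfolding n_def a_def
        by (simp add: nth_rotate1 del: mod_less_divisor)
      finally show "snd (p ! i) = snd (a i, a (Suc i mod n))"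
        by simp
    qed (simp add: a_def)
    have inj: "inj_on a {..<n}"
      using p(2) by (auto simp: inj_on_def a_def n_def distinct_conv_nth)
    have arc: "(a i, a (Suc i mod n)) \<in> set p" if "i < n" for i
      using nth[OF that] that by (metis n_def nth_mem)
    have in_p: "a i \<in> fst ` set p" if "i < n" for i
      using arc[OF that] by force
    \<comment> \<open>Tails are distinct, so the tail \<open>a i\<close> fixes the position of the
      arc on the cycle and with it the head.\<close>
    have cyc: "Suc i mod n = j" if ij: "(a i, a j) \<in> set p" "i < n" "j < n" for i j
    proof -
      obtain k where k: "k < n" "p ! k = (a i, a j)"
        using ij(1) by (auto simp: in_set_conv_nth n_def)
      have "Suc k mod n < n"
        using k(1) by simp
      then show ?thesis
        using k nth[OF k(1)] ij inj_onD[OF inj] by (metis lessThan_iff prod.inject)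
    qed
    have "(a i, a j) \<in> parcs G \<longleftrightarrow> Suc i mod n = j \<or> Suc j mod n = i"
      if "i < n" "j < n" for i j
    proof
      assume "(a i, a j) \<in> parcs G"
      then have "(a i, a j) \<in> set p \<or> (a j, a i) \<in> set p"
        using no_chord[of "a i" "a j"] in_p[OF that(1)] in_p[OF that(2)]
        by (simp add: chord_def)
      then show "Suc i mod n = j \<or> Suc j mod n = i"
        using cyc that by blast
    next
      assume "Suc i mod n = j \<or> Suc j mod n = i"
      then show "(a i, a j) \<in> parcs G"
        using arc p(1) that arcs_symmetric by blast
    qed
    then show ?thesis
      using inj \<open>3 < length p\<close> unfolding hole_def n_def by blast
  qed
  have "\<not> chordal G" if h: "hole G n a" for n a
  proof -
    define p where "p = map (\<lambda>i. (a i, a (Suc i mod n))) [0..<n]"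
    have n: "3 < n" and inj: "inj_on a {..<n}"
      and adj: "\<And>i j. i < n \<Longrightarrow> j < n \<Longrightarrow>
        (a i, a j) \<in> parcs G \<longleftrightarrow> Suc i mod n = j \<or> Suc j mod n = i"
      using h by (auto simp: hole_def)
    have fst: "map fst p = map a [0..<n]"
      by (simp add: p_def)
    have "map snd p = rotate1 (map fst p)"
      unfolding fst by (rule nth_equalityI) (auto simp: p_def nth_rotate1)
    moreover have "distinct (map fst p)"
      using inj by (simp add: fst distinct_map atLeast0LessThan)
    moreover have "set p \<subseteq> parcs G"
      using adj by (auto simp: p_def)
    ultimately have "cycle p"
      using n by (auto simp: cycle_iff_rotate1 p_def)
    moreover have "\<not> chord G p u v" for u v
    proof
      assume c: "chord G p u v"
      have "fst ` set p = a ` {..<n}"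
        by (auto simp: p_def image_image)
      with c obtain i j where ij: "i < n" "j < n" "u = a i" "v = a j"
        by (auto simp: chord_def)
      then show False
        using c adj[OF ij(1,2)] by (auto simp: chord_def p_def)
    qed
    ultimately show ?thesis
      using n by (auto simp: chordal_def p_def)
  qed
  then show ?thesis
    using hole_if unfolding chordal_def by blast
qed

section \<open>Moving along a hole\<close>

text \<open>Adding \<open>s\<close> modulo \<open>n\<close> is injective on residues and commutes
  with the cyclic successor.\<close>

lemma hole_rotate:
  assumes "hole G n a"
  shows "hole G n (\<lambda>k. a ((s + k) mod n))"
proof -
  have n: "3 < n" and inj: "inj_on a {..<n}"
    and adj: "\<And>i j. i < n \<Longrightarrow> j < n \<Longrightarrow>
      (a i, a j) \<in> parcs G \<longleftrightarrow> Suc i mod n = j \<or> Suc j mod n = i"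
    using assms by (auto simp: hole_def)
  have shift: "(s + i) mod n = (s + j) mod n \<longleftrightarrow> i mod n = j mod n" for i j
    by (metis cong_add_lcancel_nat cong_def)
  have succ: "Suc ((s + i) mod n) mod n = (s + j) mod n \<longleftrightarrow> Suc i mod n = j"
    if "j < n" for i j
    using shift[of "Suc i" j] that by (simp add: mod_Suc_eq)
  have "inj_on (\<lambda>k. a ((s + k) mod n)) {..<n}"
    using n shift by (auto intro!: inj_onI dest!: inj_onD[OF inj])
  then show ?thesis
    using n by (auto simp: hole_def adj succ)
qed

text \<open>The reflection of the indices exchanges cyclic successor and predecessor, and the
  adjacency condition is symmetric in the two.\<close>

lemma hole_rev:
  assumes "hole G n a"
  shows "hole G n (\<lambda>k. a (n - Suc k))"
proof -
  have n: "3 < n" and inj: "inj_on a {..<n}"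
    and adj: "\<And>i j. i < n \<Longrightarrow> j < n \<Longrightarrow>
      (a i, a j) \<in> parcs G \<longleftrightarrow> Suc i mod n = j \<or> Suc j mod n = i"
    using assms by (auto simp: hole_def)
  have succ: "Suc (n - Suc i) mod n = n - Suc j \<longleftrightarrow> Suc j mod n = i" if "i < n" "j < n" for i j
    using that by (auto simp: mod_Suc)
  have "inj_on (\<lambda>k. a (n - Suc k)) {..<n}"
    using n by (auto intro!: inj_onI dest!: inj_onD[OF inj])
  then show ?thesis
    using n by (auto simp: hole_def adj succ)
qed

text \<open>Adjacent vertices of a hole are cyclically consecutive. If \<open>y\<close> precedes
  \<open>x\<close>, rotating the hole to start at \<open>x\<close> suffices; if \<open>y\<close>
  follows \<open>x\<close>, the hole is rotated to start at \<open>y\<close> and then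
  reversed.\<close>

lemma hole_start_end:
  assumes h: "hole G n a" and x: "x \<in> a ` {..<n}" and y: "y \<in> a ` {..<n}"
    and xy: "(x, y) \<in> parcs G"
  obtains b where "hole G n b" "b 0 = x" "b (n - 1) = y"
proof -
  \<comment> \<open>A rotation that starts just after \<open>i\<close> has \<open>i\<close> as its
    last index.\<close>
  have wrap: "(Suc i mod n + (n - 1)) mod n = i" if "i < n" for i
  proof -
    have "(Suc i mod n + (n - 1)) mod n = (Suc i + (n - 1)) mod n"
      by (rule mod_add_left_eq)
    also have "Suc i + (n - 1) = i + n"
      using that by simp
    finally show ?thesis
      using that by simp
  qed
  obtain i j where ij: "i < n" "j < n" "x = a i" "y = a j"
    using x y by auto
  with h xy consider "Suc j mod n = i" | "Suc i mod n = j"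
    by (auto simp: hole_def)
  then show thesis
  proof cases
    case 1
    then show thesis
      using that[OF hole_rotate[OF h, of i]] wrap[OF ij(2)] ij by auto
  next
    case 2
    then show thesis
      using that[OF hole_rev[OF hole_rotate[OF h, of j]]] wrap[OF ij(1)] ij by auto
  qed
qed

section \<open>Induced paths in chordal graphs\<close>

text \<open>Here \<open>n\<close> counts vertices, so the ends are \<open>b 0\<close> and
  \<open>b (n - 1)\<close>; unlike in \<open>hole\<close>, indices do not wrap around.\<close>

definition induced_path :: "'a pair_pre_digraph \<Rightarrow> nat \<Rightarrow> (nat \<Rightarrow> 'a) \<Rightarrow> bool" where
  "induced_path G n b \<longleftrightarrow> inj_on b {..<n} \<and>
     (\<forall>i<n. \<forall>j<n. (b i, b j) \<in> parcs G \<longleftrightarrow> j = Suc i \<or> i = Suc j)"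

text \<open>If \<open>z\<close> missed \<open>b k\<close>, then its nearest neighbours on the path
  before and after \<open>b k\<close>, the section between them and \<open>z\<close> itself would
  form a hole.\<close>

lemma adjacent_to_induced_path:
  assumes G: "pair_graph G" "chordal G" and b: "induced_path G n b"
    and z: "z \<notin> b ` {..<n}" "(z, b 0) \<in> parcs G" "(z, b (n - 1)) \<in> parcs G"
    and "k < n"
  shows "(z, b k) \<in> parcs G"
proof (rule ccontr)
  interpret pair_graph G by fact
  assume k: "(z, b k) \<notin> parcs G"
  have inj: "inj_on b {..<n}"
    and adj: "\<And>i j. i < n \<Longrightarrow> j < n \<Longrightarrow> (b i, b j) \<in> parcs G \<longleftrightarrow> j = Suc i \<or> i = Suc j"
    using b by (auto simp: induced_path_def)
  define L R where "L = {i. i < k \<and> (z, b i) \<in> parcs G}"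
    and "R = {i. k < i \<and> i < n \<and> (z, b i) \<in> parcs G}"
  define l r where "l = Max L" and "r = Min R"
  have fin: "finite L" "finite R"
    by (auto simp: L_def R_def)
  have "k \<noteq> 0" "k \<noteq> n - 1"
    using k z by (metis, metis)
  then have "0 \<in> L" "n - 1 \<in> R"
    using z \<open>k < n\<close> by (auto simp: L_def R_def)
  then have "l \<in> L" "r \<in> R"
    using fin Max_in Min_in unfolding l_def r_def by (metis empty_iff)+
  then have lr: "l < k" "k < r" "r < n" "(z, b l) \<in> parcs G" "(z, b r) \<in> parcs G"
    by (auto simp: L_def R_def)
  have gap: "(z, b i) \<notin> parcs G" if "l < i" "i < r" for i
  proof
    assume "(z, b i) \<in> parcs G"
    then have "i \<in> L \<or> i \<in> R"
      using that k lr by (cases i k rule: linorder_cases) (auto simp: L_def R_def)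
    then show False
      using Max_ge[OF fin(1)] Min_le[OF fin(2)] that by (fastforce simp: l_def r_def)
  qed
  define d where "d = r - l"
  \<comment> \<open>Indices up to \<open>d\<close> run along the section from \<open>b l\<close> to
    \<open>b r\<close>, and index \<open>d + 1\<close> is \<open>z\<close>. As \<open>k\<close> lies
    strictly between \<open>l\<close> and \<open>r\<close>, \<open>d\<close> is at least 2 and the
    cycle has at least four vertices.\<close>
  define c where "c = (\<lambda>i. if i \<le> d then b (l + i) else z)"
  have d: "2 \<le> d" "l + d = r"
    using lr by (auto simp: d_def)
  have zb: "(z, b (l + i)) \<in> parcs G \<longleftrightarrow> i = 0 \<or> i = d" if "i \<le> d" for i
    using gap[of "l + i"] that lr d by (cases "i = 0 \<or> i = d") auto
  then have bz: "(b (l + i), z) \<in> parcs G \<longleftrightarrow> i = 0 \<or> i = d" if "i \<le> d" for i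
    using that arcs_symmetric by blast
  have "hole G (d + 2) c"
    unfolding hole_def
  proof (intro conjI allI impI)
    show "3 < d + 2"
      using d by simp
    show "inj_on c {..<d + 2}"
    proof (rule inj_onI)
      fix i j assume "i \<in> {..<d + 2}" "j \<in> {..<d + 2}" "c i = c j"
      moreover have "b (l + i) \<noteq> z" if "i \<le> d" for i
        using z(1) that d lr by auto
      ultimately show "i = j"
        using inj_onD[OF inj, of "l + i" "l + j"] d lr
        by (auto simp: c_def split: if_splits)
    qed
    fix i j assume ij: "i < d + 2" "j < d + 2"
    have "(z, z) \<notin> parcs G"
      using no_loops' by blast
    then show "(c i, c j) \<in> parcs G \<longleftrightarrow> Suc i mod (d + 2) = j \<or> Suc j mod (d + 2) = i"
      using ij d lr adj[of "l + i" "l + j"] zb bz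
      by (cases "i \<le> d"; cases "j \<le> d") (auto simp: c_def mod_Suc)
  qed
  then show False
    using G chordal_iff_no_hole by blast
qed

section \<open>Adding an edge at a nondominating vertex\<close>

lemma ex_nonadjacent_if_not_dominating:
  assumes "pair_graph G" "x \<in> pverts G" "\<not> dominating G x"
  obtains y where "y \<in> pverts G" "y \<noteq> x" "(x, y) \<notin> parcs G"
proof -
  interpret pair_graph G by fact
  have "dominating G x" if all: "\<And>y. y \<in> pverts G \<Longrightarrow> y \<noteq> x \<Longrightarrow> (x, y) \<in> parcs G"
  proof -
    have "out_arcs G x = Pair x ` (pverts G - {x})"
      using all wellformed' no_loops'[of x x] by (auto simp: out_arcs_def image_iff)
    then have "out_degree G x = card (pverts G - {x})"
      by (simp add: out_degree_def card_image inj_on_def)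
    then show ?thesis
      using assms(2) by (simp add: dominating_def)
  qed
  then show thesis
    using that assms(3) by blast
qed

text \<open>A hole of the enlarged graph must use the new edge, since \<open>G\<close> has no hole.
  Cutting it open at that edge leaves an induced path of \<open>G\<close> from \<open>x\<close> to
  \<open>y\<close>.\<close>

lemma induced_path_if_not_chordal_add_edge:
  assumes G: "pair_graph G" "chordal G" and xy: "x \<in> pverts G" "y \<in> pverts G" "x \<noteq> y"
    "(x, y) \<notin> parcs G" and "\<not> chordal (add_edge G x y)"
  obtains n b where "3 < n" "induced_path G n b" "b 0 = x" "b (n - 1) = y"
proof -
  interpret pair_graph G by fact
  have yx: "(y, x) \<notin> parcs G"
    using xy arcs_symmetric by blast
  have arcs: "(u, v) \<in> parcs (add_edge G x y) \<longleftrightarrow>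
      (u, v) \<in> parcs G \<or> u = x \<and> v = y \<or> u = y \<and> v = x" for u v
    by (auto simp: add_edge_def)
  obtain n a where a: "hole (add_edge G x y) n a"
    using chordal_iff_no_hole[OF pair_graph_add_edge[OF G(1) xy(1-3)]] assms(7) by blast
  \<comment> \<open>On a vertex set missing \<open>x\<close> or \<open>y\<close> both graphs have
    the same arcs, so the hole would already be one of \<open>G\<close>.\<close>
  have "x \<in> a ` {..<n} \<and> y \<in> a ` {..<n}"
  proof (rule ccontr)
    assume "\<not> (x \<in> a ` {..<n} \<and> y \<in> a ` {..<n})"
    then have "(a i, a j) \<in> parcs (add_edge G x y) \<longleftrightarrow> (a i, a j) \<in> parcs G"
      if "i < n" "j < n" for i j
      using that by (auto simp: arcs)
    then have "hole G n a"
      using a by (auto simp: hole_def)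
    then show False
      using G chordal_iff_no_hole by blast
  qed
  then obtain b where b: "hole (add_edge G x y) n b" "b 0 = x" "b (n - 1) = y"
    using hole_start_end[OF a] arcs by metis
  then have n: "3 < n" and inj: "inj_on b {..<n}"
    and adj: "\<And>i j. i < n \<Longrightarrow> j < n \<Longrightarrow>
      (b i, b j) \<in> parcs (add_edge G x y) \<longleftrightarrow> Suc i mod n = j \<or> Suc j mod n = i"
    by (auto simp: hole_def)
  have "(b i, b j) \<in> parcs G \<longleftrightarrow> j = Suc i \<or> i = Suc j" if ij: "i < n" "j < n" for i j
  proof -
    \<comment> \<open>The new edge joins exactly the indices \<open>0\<close> and
      \<open>n - 1\<close>, so deleting it removes the wrap-around adjacency and no other.\<close>
    have x_iff: "b k = x \<longleftrightarrow> k = 0" and y_iff: "b k = y \<longleftrightarrow> k = n - 1" if "k < n" for k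
      using that n b inj_onD[OF inj, of k 0] inj_onD[OF inj, of k "n - 1"] by auto
    have "(b i, b j) \<in> parcs G \<longleftrightarrow> (b i, b j) \<in> parcs (add_edge G x y) \<and>
        \<not> (b i = x \<and> b j = y) \<and> \<not> (b i = y \<and> b j = x)"
      using xy yx by (auto simp: arcs)
    also have "\<dots> \<longleftrightarrow> j = Suc i \<or> i = Suc j"
      using ij n by (auto simp: adj x_iff y_iff mod_Suc)
    finally show ?thesis .
  qed
  then have "induced_path G n b"
    using inj by (simp add: induced_path_def)
  then show thesis
    using that n b by blast
qed

theorem lemma2:
  fixes G :: "'a pair_pre_digraph" and x :: 'a
  assumes "pair_graph G"
    and "chordal G"
    and "x \<in> pverts G"
    and "\<not> dominating G x"
  shows "\<exists>y \<in> pverts G. y \<noteq> x \<and> (x, y) \<notin> parcs G \<and> chordal (add_edge G x y)"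
proof -
  interpret pair_graph G by fact
  define common where "common = (\<lambda>y. {z. (z, x) \<in> parcs G \<and> (z, y) \<in> parcs G})"
  define Y where "Y = {y \<in> pverts G. y \<noteq> x \<and> (x, y) \<notin> parcs G}"
  have "finite Y" "Y \<noteq> {}"
    using pair_finite_verts ex_nonadjacent_if_not_dominating[OF assms(1,3,4)]
    by (auto simp: Y_def)
  then have "Max ((card \<circ> common) ` Y) \<in> (card \<circ> common) ` Y"
    by (intro Max_in) auto
  then obtain y where y: "y \<in> Y" and "Max ((card \<circ> common) ` Y) = card (common y)"
    by auto
  then have max: "card (common v) \<le> card (common y)" if "v \<in> Y" for v
    using \<open>finite Y\<close> that Max_ge[of "(card \<circ> common) ` Y" "card (common v)"] by auto
  have "chordal (add_edge G x y)"
  proof (rule ccontr)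
    assume "\<not> chordal (add_edge G x y)"
    moreover have "y \<in> pverts G" "x \<noteq> y" "(x, y) \<notin> parcs G"
      using y by (auto simp: Y_def)
    ultimately obtain n b where n: "3 < n" and path: "induced_path G n b"
      and ends: "b 0 = x" "b (n - 1) = y"
      using induced_path_if_not_chordal_add_edge assms(1-3) by metis
    then have adj: "\<And>i j. i < n \<Longrightarrow> j < n \<Longrightarrow>
        (b i, b j) \<in> parcs G \<longleftrightarrow> j = Suc i \<or> i = Suc j" and inj: "inj_on b {..<n}"
      by (auto simp: induced_path_def)
    have sub: "common y \<subseteq> common (b 2)"
    proof
      fix z assume z: "z \<in> common y"
      \<comment> \<open>A path vertex adjacent to both ends would have index 1 and index
        \<open>n - 2\<close>, which differ because \<open>3 < n\<close>. Hence \<open>z\<close> lies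
        off the path, as \<open>adjacent_to_induced_path\<close> requires.\<close>
      have "z \<noteq> b k" if "k < n" for k
        using z adj[OF that, of 0] adj[OF that, of "n - 1"] n that ends
        by (auto simp: common_def)
      then show "z \<in> common (b 2)"
        using z n ends adjacent_to_induced_path[OF assms(1,2) path, of z 2]
        by (auto simp: common_def)
    qed
    \<comment> \<open>Here \<open>3 < n\<close> ensures that \<open>y\<close>, with index
      \<open>n - 1\<close>, is not the path neighbour \<open>b 2\<close> of
      \<open>b 1\<close>.\<close>
    have "b 1 \<in> common (b 2)" "b 1 \<notin> common y"
      using adj[of 1 0] adj[of 1 2] adj[of 1 "n - 1"] n ends by (auto simp: common_def)
    with sub have "common y \<subset> common (b 2)"
      by blast
    moreover have "finite (common (b 2))"
      using pair_finite_verts by (rule finite_subset[rotated]) (auto simp: common_def wellformed')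
    ultimately have "card (common y) < card (common (b 2))"
      by (simp add: psubset_card_mono)
    \<comment> \<open>The indices 0 and 2 are not consecutive, so \<open>b 2\<close> is itself a
      candidate for the new edge; it is a vertex of \<open>G\<close> as the tail of the arc to
      \<open>b 1\<close>.\<close>
    moreover have "b 2 \<in> Y"
      using adj[of 0 2] adj[of 2 1] inj_onD[OF inj, of 2 0] n ends in_arcsD1[of "b 2" "b 1"]
      by (auto simp: Y_def)
    ultimately show False
      using max by (meson linorder_not_less)
  qed
  with y show ?thesis
    by (auto simp: Y_def)
qed

end
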